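(* Every Hausdorff locally compact semigroup topology on the semigroup $\mathscr{C}_{\mathbb{Z}}^{\mathbf{0}}$ (the extended bicyclic semigroup with adjoined zero) is discrete.
   Context: The extended bicyclic semigroup is the set $\mathscr{C}_{\mathbb{Z}}=\mathbb{Z}\times\mathbb{Z}$ with the operation $(a,b)\cdot(c,d)=(a-b+c,d)$ if $b<c$; $(a,b)\cdot(c,d)=(a,d)$ if $b=c$; $(a,b)\cdot(c,d)=(a,d+b-c)$ if $b>c$. $\mathscr{C}_{\mathbb{Z}}^{\mathbf{0}}=\mathscr{C}_{\mathbb{Z}}\sqcup\{\mathbf{0}\}$ is $\mathscr{C}_{\mathbb{Z}}$ with an adjoined zero $\mathbf{0}$ (so $\mathbf{0}\cdot s=s\cdot\mathbf{0}=\mathbf{0}$ for all $s$). A topology $\tau$ on a semigroup $S$ is a semigroup topology if $(S,\tau)$ is a topological semigroup, i.e. the multiplication $S\times S\to S$ is (jointly) continuous. *)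

theory Defs
  imports "HOL-Analysis.Analysis"
begin

fun ext_bicyclic_mult :: "int \<times> int \<Rightarrow> int \<times> int \<Rightarrow> int \<times> int" where
  "ext_bicyclic_mult (a, b) (c, d) =
     (if b < c then (a - b + c, d)
      else if b = c then (a, d)
      else (a, d + b - c))"

text \<open>A zero is adjoined by passing to the option type: \<open>None\<close> is the zero.\<close>

fun adjoin_zero_mult :: "('a \<Rightarrow> 'a \<Rightarrow> 'a) \<Rightarrow> 'a option \<Rightarrow> 'a option \<Rightarrow> 'a option" where
  "adjoin_zero_mult m (Some x) (Some y) = Some (m x y)"
| "adjoin_zero_mult m None y = None"
| "adjoin_zero_mult m x None = None"

definition ext_bicyclic0_mult ::
    "(int \<times> int) option \<Rightarrow> (int \<times> int) option \<Rightarrow> (int \<times> int) option" where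
  "ext_bicyclic0_mult = adjoin_zero_mult ext_bicyclic_mult"

lemma semigroup_ext_bicyclic_mult: "semigroup ext_bicyclic_mult"
proof
  fix x y z :: "int \<times> int"
  show "ext_bicyclic_mult (ext_bicyclic_mult x y) z =
        ext_bicyclic_mult x (ext_bicyclic_mult y z)"
    by (cases x; cases y; cases z) auto
qed

lemma semigroup_adjoin_zero_mult:
  assumes "semigroup m"
  shows "semigroup (adjoin_zero_mult m)"
proof
  fix x y z :: "'a option"
  show "adjoin_zero_mult m (adjoin_zero_mult m x y) z =
        adjoin_zero_mult m x (adjoin_zero_mult m y z)"
    using semigroup.assoc[OF assms] by (cases x; cases y; cases z) auto
qed

lemma semigroup_ext_bicyclic0_mult: "semigroup ext_bicyclic0_mult"
  unfolding ext_bicyclic0_mult_def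
  by (intro semigroup_adjoin_zero_mult semigroup_ext_bicyclic_mult)

text \<open>The underlying set of the semigroup is the whole type \<open>'a\<close>, and continuity of
  the multiplication is joint continuity, with respect to the product topology.\<close>

definition semigroup_topology :: "('a \<Rightarrow> 'a \<Rightarrow> 'a) \<Rightarrow> 'a topology \<Rightarrow> bool" where
  "semigroup_topology m T \<longleftrightarrow>
     semigroup m \<and> topspace T = UNIV \<and>
     continuous_map (prod_topology T T) T (\<lambda>(x, y). m x y)"

end

theory Submission
  imports Defs
begin

text \<open>
  The space is countable, locally compact and Hausdorff, so by Baire's theorem some nonzero point
  is isolated; two-sided translations carry this over to all nonzero points.

  Suppose that zero is not isolated, and let \<open>A\<close> be the infinite set of nonzero elements of a
  compact neighbourhood of zero. As nonzero points are isolated, every neighbourhood of zero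
  contains almost all of \<open>A\<close>. Hence translations map almost all of \<open>A\<close> into \<open>A\<close> and have
  finite fibres on \<open>A\<close>. Pushing elements of \<open>A\<close> around by translations, one finds that
  \<open>A\<close> contains \<open>(0, m)\<close> and \<open>(m, 0)\<close> for all large \<open>m\<close>. Both tend to zero, but their product
  is always \<open>(0, 0)\<close>, contradicting joint continuity.
\<close>

section \<open>Combinatorics of translations on integer pairs\<close>

lemma ext_bicyclic_mult_swap:
  "ext_bicyclic_mult (prod.swap x) (prod.swap y) = prod.swap (ext_bicyclic_mult y x)"
  by (cases x; cases y) auto

lemma infinite_int_gt:
  fixes M :: "int set"
  assumes "infinite M" "\<And>m. m \<in> M \<Longrightarrow> 0 < m"
  obtains m where "m \<in> M" "N < m"
proof -
  have "\<not> M \<subseteq> {0..N}"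
    using assms(1) finite_subset by blast
  then show ?thesis
    using assms(2) that by force
qed

text \<open>These are the properties of the punctured compact neighbourhoods of a non-isolated zero.\<close>

locale translation_stable =
  fixes A :: "(int \<times> int) set"
  assumes left_stable: "finite {z \<in> A. ext_bicyclic_mult s z \<notin> A}"
    and right_stable: "finite {z \<in> A. ext_bicyclic_mult z s \<notin> A}"
    and left_fibre: "finite {z \<in> A. ext_bicyclic_mult s z = w}"
    and right_fibre: "finite {z \<in> A. ext_bicyclic_mult z s = w}"
begin

text \<open>Swapping coordinates reverses products, so it exchanges the left and right conditions.
  Facts about the row \<open>(0, m)\<close> thus transfer to the column
  \<open>(m, 0)\<close>.\<close>

lemma translation_stable_swap: "translation_stable (prod.swap ` A)"
proof -
  have *: "finite {z \<in> prod.swap ` A. P z}" if "finite {z \<in> A. P (prod.swap z)}" for P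
    using finite_imageI[OF that, of prod.swap] by (rule rev_finite_subset) auto
  have mem: "z \<in> prod.swap ` A \<longleftrightarrow> prod.swap z \<in> A" for z
    by (metis image_iff prod.swap_def swap_swap)
  have l: "prod.swap (ext_bicyclic_mult s (prod.swap z)) = ext_bicyclic_mult z (prod.swap s)"
    and r: "prod.swap (ext_bicyclic_mult (prod.swap z) s) = ext_bicyclic_mult (prod.swap s) z" for s z
    by (metis ext_bicyclic_mult_swap swap_swap)+
  have l': "ext_bicyclic_mult s (prod.swap z) = w \<longleftrightarrow> ext_bicyclic_mult z (prod.swap s) = prod.swap w"
    and r': "ext_bicyclic_mult (prod.swap z) s = w \<longleftrightarrow> ext_bicyclic_mult (prod.swap s) z = prod.swap w" for s z w
    by (metis l r swap_swap)+
  show ?thesis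
  proof
    fix s w
    show "finite {z \<in> prod.swap ` A. ext_bicyclic_mult s z \<notin> prod.swap ` A}"
      by (rule *) (simp add: mem l right_stable)
    show "finite {z \<in> prod.swap ` A. ext_bicyclic_mult z s \<notin> prod.swap ` A}"
      by (rule *) (simp add: mem r left_stable)
    show "finite {z \<in> prod.swap ` A. ext_bicyclic_mult s z = w}"
      by (rule *, rule finite_subset[OF _ right_fibre[of "prod.swap s" "prod.swap w"]]) (use l' in blast)
    show "finite {z \<in> prod.swap ` A. ext_bicyclic_mult z s = w}"
      by (rule *, rule finite_subset[OF _ left_fibre[of "prod.swap s" "prod.swap w"]]) (use r' in blast)
  qed
qed

text \<open>Were the image finite, \<open>Z\<close> would be covered by the finitely many points
  thrown out of \<open>A\<close> and finitely many finite fibres.\<close>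

lemma infinite_left_translate:
  assumes "Z \<subseteq> A" "infinite Z"
  shows "infinite (A \<inter> ext_bicyclic_mult s ` Z)"
proof
  let ?W = "A \<inter> ext_bicyclic_mult s ` Z"
  assume "finite ?W"
  then have "finite ({z \<in> A. ext_bicyclic_mult s z \<notin> A} \<union> (\<Union>w\<in>?W. {z \<in> A. ext_bicyclic_mult s z = w}))"
    using left_stable left_fibre by blast
  moreover have "Z \<subseteq> {z \<in> A. ext_bicyclic_mult s z \<notin> A} \<union> (\<Union>w\<in>?W. {z \<in> A. ext_bicyclic_mult s z = w})"
    using assms(1) by blast
  ultimately show False
    using assms(2) finite_subset by blast
qed

lemma infinite_right_translate:
  assumes "Z \<subseteq> A" "infinite Z"
  shows "infinite (A \<inter> (\<lambda>z. ext_bicyclic_mult z s) ` Z)"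
proof
  let ?W = "A \<inter> (\<lambda>z. ext_bicyclic_mult z s) ` Z"
  assume "finite ?W"
  then have "finite ({z \<in> A. ext_bicyclic_mult z s \<notin> A} \<union> (\<Union>w\<in>?W. {z \<in> A. ext_bicyclic_mult z s = w}))"
    using right_stable right_fibre by blast
  moreover have "Z \<subseteq> {z \<in> A. ext_bicyclic_mult z s \<notin> A} \<union> (\<Union>w\<in>?W. {z \<in> A. ext_bicyclic_mult z s = w})"
    using assms(1) by blast
  ultimately show False
    using assms(2) finite_subset by blast
qed

lemma left_stable_bound:
  obtains N where "\<And>u v. (u, v) \<in> A \<Longrightarrow> N < v \<Longrightarrow> ext_bicyclic_mult s (u, v) \<in> A"
proof -
  obtain N where "\<And>v. v \<in> snd ` {z \<in> A. ext_bicyclic_mult s z \<notin> A} \<Longrightarrow> v \<le> N"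
    using left_stable[of s] finite_imageI bdd_above_finite unfolding bdd_above_def by meson
  then have "ext_bicyclic_mult s (u, v) \<in> A" if "(u, v) \<in> A" "N < v" for u v
    using that by force
  then show ?thesis
    using that by blast
qed

lemma right_stable_bound:
  obtains N where "\<And>u v. (u, v) \<in> A \<Longrightarrow> N < v \<Longrightarrow> ext_bicyclic_mult (u, v) s \<in> A"
proof -
  obtain N where "\<And>v. v \<in> snd ` {z \<in> A. ext_bicyclic_mult z s \<notin> A} \<Longrightarrow> v \<le> N"
    using right_stable[of s] finite_imageI bdd_above_finite unfolding bdd_above_def by meson
  then have "ext_bicyclic_mult (u, v) s \<in> A" if "(u, v) \<in> A" "N < v" for u v
    using that by force
  then show ?thesis
    using that by blast
qed

text \<open>For \<open>m > 0\<close>, right multiplication by \<open>(0, 1)\<close> sends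
  \<open>(0, m)\<close> to \<open>(0, m + 1)\<close>; one starting point beyond all exceptions
  suffices.\<close>

lemma row_cofinite:
  assumes "infinite {m. 0 < m \<and> (0, m) \<in> A}"
  shows "\<exists>m0. \<forall>m\<ge>m0. (0, m) \<in> A"
proof -
  obtain N where N: "\<And>u v. (u, v) \<in> A \<Longrightarrow> N < v \<Longrightarrow> ext_bicyclic_mult (u, v) (0, 1) \<in> A"
    using right_stable_bound by blast
  obtain m0 where m0: "0 < m0" "(0, m0) \<in> A" "N < m0"
    using infinite_int_gt[OF assms, of N] by blast
  have "(0, m) \<in> A" if "m0 \<le> m" for m
    using that
  proof (induction m rule: int_ge_induct)
    case (step i)
    then show ?case
      using N[of 0 i] m0 by (simp add: add.commute)
  qed (use m0 in simp)
  then show ?thesis by blast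
qed

text \<open>Left multiplication by \<open>(1, 0)\<close> raises the first coordinate from
  \<open>(0, m)\<close> on, with \<open>m\<close> fixed beyond all exceptions; right multiplication
  by \<open>(m, 0)\<close> then sends \<open>(u, m)\<close> to \<open>(u, 0)\<close>.\<close>

lemma infinite_column_if_row:
  assumes "infinite {m. 0 < m \<and> (0, m) \<in> A}"
  shows "infinite {m. 0 < m \<and> (m, 0) \<in> A}"
proof -
  obtain N where N: "\<And>u v. (u, v) \<in> A \<Longrightarrow> N < v \<Longrightarrow> ext_bicyclic_mult (1, 0) (u, v) \<in> A"
    using left_stable_bound by blast
  obtain m where m: "0 < m" "(0, m) \<in> A" "N < m"
    using infinite_int_gt[OF assms, of N] by blast
  have col: "(u, m) \<in> A" if "0 \<le> u" for u
    using that
  proof (induction u rule: int_ge_induct)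
    case (step i)
    then show ?case
      using N[of i m] m by (auto simp: add.commute split: if_splits)
  qed (use m in simp)
  let ?Z = "(\<lambda>u. (u, m)) ` {1::int..}"
  have "infinite ?Z"
    using infinite_Ici[of "1::int"] by (simp add: finite_image_iff inj_on_def)
  moreover have "?Z \<subseteq> A"
    using col by auto
  ultimately have "infinite (A \<inter> (\<lambda>z. ext_bicyclic_mult z (m, 0)) ` ?Z)"
    using infinite_right_translate by blast
  moreover have "A \<inter> (\<lambda>z. ext_bicyclic_mult z (m, 0)) ` ?Z \<subseteq> (\<lambda>u. (u, 0)) ` {m. 0 < m \<and> (m, 0) \<in> A}"
    by auto
  ultimately show ?thesis
    using finite_imageI finite_subset by blast
qed

lemma row_or_column_if_lower:
  assumes "infinite {z \<in> A. fst z \<le> 0}"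
  shows "infinite {m. 0 < m \<and> (0, m) \<in> A} \<or> infinite {m. 0 < m \<and> (m, 0) \<in> A}"
proof (rule ccontr)
  assume fin: "\<not> ?thesis"
  define M where "M = {n. (0, n) \<in> A}"
  \<comment> \<open>For \<open>u \<le> 0\<close>, left multiplication by \<open>(0, 0)\<close> sends
    \<open>(u, v)\<close> to \<open>(0, v - u)\<close>.\<close>
  have "infinite (A \<inter> ext_bicyclic_mult (0, 0) ` {z \<in> A. fst z \<le> 0})"
    using assms by (intro infinite_left_translate) auto
  moreover have "A \<inter> ext_bicyclic_mult (0, 0) ` {z \<in> A. fst z \<le> 0} \<subseteq> Pair 0 ` M"
    by (auto simp: M_def)
  ultimately have "infinite M"
    using finite_imageI finite_subset by blast
  moreover have "M \<subseteq> {m. 0 < m \<and> (0, m) \<in> A} \<union> {0} \<union> (M \<inter> {..<0})"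
    by (auto simp: M_def)
  ultimately have "infinite (M \<inter> {..<0})"
    using fin by (meson finite.emptyI finite.insertI finite_UnI finite_subset)
  then have "infinite (Pair (0::int) ` (M \<inter> {..<0}))"
    by (simp add: finite_image_iff inj_on_def)
  \<comment> \<open>For \<open>n < 0\<close>, right multiplication by \<open>(0, 0)\<close> turns
    \<open>(0, n)\<close> into \<open>(- n, 0)\<close>, a positive column element.\<close>
  then have "infinite (A \<inter> (\<lambda>z. ext_bicyclic_mult z (0, 0)) ` Pair 0 ` (M \<inter> {..<0}))"
    by (intro infinite_right_translate) (auto simp: M_def)
  moreover have "A \<inter> (\<lambda>z. ext_bicyclic_mult z (0, 0)) ` Pair 0 ` (M \<inter> {..<0})
      \<subseteq> (\<lambda>u. (u, 0)) ` {m. 0 < m \<and> (m, 0) \<in> A}"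
    by auto
  ultimately show False
    using fin by (meson finite_imageI finite_subset)
qed

text \<open>If the second coordinates take finitely many values, one value \<open>k\<close> recurs
  infinitely often and right multiplication by \<open>(k, 0)\<close> gives column elements.
  Otherwise, for large \<open>v\<close>, left multiplication by \<open>(0, 1)\<close> lowers the
  first coordinate step by step to \<open>0\<close>.\<close>

lemma row_or_column_if_quadrant:
  assumes "infinite {z \<in> A. 0 < fst z \<and> 0 < snd z}"
  shows "infinite {m. 0 < m \<and> (0, m) \<in> A} \<or> infinite {m. 0 < m \<and> (m, 0) \<in> A}"
proof (cases "finite (snd ` {z \<in> A. 0 < fst z \<and> 0 < snd z})")
  case True
  then obtain k where "infinite {z \<in> {z \<in> A. 0 < fst z \<and> 0 < snd z}. snd z = k}"
    using pigeonhole_infinite[OF assms] by fastforce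
  then have "infinite (A \<inter> (\<lambda>z. ext_bicyclic_mult z (k, 0)) ` {z \<in> {z \<in> A. 0 < fst z \<and> 0 < snd z}. snd z = k})"
    by (intro infinite_right_translate) auto
  moreover have "A \<inter> (\<lambda>z. ext_bicyclic_mult z (k, 0)) ` {z \<in> {z \<in> A. 0 < fst z \<and> 0 < snd z}. snd z = k}
      \<subseteq> (\<lambda>u. (u, 0)) ` {m. 0 < m \<and> (m, 0) \<in> A}"
    by auto
  ultimately show ?thesis
    using finite_imageI finite_subset by blast
next
  case False
  obtain N where N: "\<And>u v. (u, v) \<in> A \<Longrightarrow> N < v \<Longrightarrow> ext_bicyclic_mult (0, 1) (u, v) \<in> A"
    using left_stable_bound by blast
  have descend: "(0, v) \<in> A" if "0 \<le> u" "N < v" "(u, v) \<in> A" for u v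
    using that(1,3)
  proof (induction u rule: int_ge_induct)
    case (step i)
    then show ?case
      using N[of "i + 1" v] that(2) by (auto split: if_splits)
  qed simp
  have "snd ` {z \<in> A. 0 < fst z \<and> 0 < snd z} \<subseteq> {0..N} \<union> {m. 0 < m \<and> (0, m) \<in> A}"
  proof
    fix v
    assume "v \<in> snd ` {z \<in> A. 0 < fst z \<and> 0 < snd z}"
    then obtain u where "(u, v) \<in> A" "0 < u" "0 < v"
      by auto
    then show "v \<in> {0..N} \<union> {m. 0 < m \<and> (0, m) \<in> A}"
      using descend[of u v] by (cases "N < v") auto
  qed
  then show ?thesis
    using False by (meson finite_UnI finite_atLeastAtMost_int finite_subset)
qed

end

lemma translation_stable_row_and_column:
  assumes "translation_stable A" "infinite A"
  shows "\<exists>m0. \<forall>m\<ge>m0. (0, m) \<in> A \<and> (m, 0) \<in> A"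
proof -
  interpret A: translation_stable A by fact
  interpret B: translation_stable "prod.swap ` A" by (rule A.translation_stable_swap)
  have mem: "(u, v) \<in> prod.swap ` A \<longleftrightarrow> (v, u) \<in> A" for u v
    by force
  have low: "infinite {z \<in> prod.swap ` A. fst z \<le> 0}" if "infinite {z \<in> A. snd z \<le> 0}"
  proof -
    have "prod.swap ` {z \<in> A. snd z \<le> 0} \<subseteq> {z \<in> prod.swap ` A. fst z \<le> 0}"
      by auto
    moreover have "infinite (prod.swap ` {z \<in> A. snd z \<le> 0})"
      using that by (simp add: finite_image_iff)
    ultimately show ?thesis
      using finite_subset by blast
  qed
  \<comment> \<open>The second of these three regions reduces to the first by swapping.\<close>
  have "A \<subseteq> {z \<in> A. fst z \<le> 0} \<union> {z \<in> A. snd z \<le> 0} \<union> {z \<in> A. 0 < fst z \<and> 0 < snd z}"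
    by auto
  then have "infinite {z \<in> A. fst z \<le> 0} \<or> infinite {z \<in> A. snd z \<le> 0}
      \<or> infinite {z \<in> A. 0 < fst z \<and> 0 < snd z}"
    using assms(2) by (meson finite_UnI finite_subset)
  then have "infinite {m. 0 < m \<and> (0, m) \<in> A} \<or> infinite {m. 0 < m \<and> (m, 0) \<in> A}"
    using A.row_or_column_if_lower A.row_or_column_if_quadrant low B.row_or_column_if_lower
    unfolding mem by blast
  then have "infinite {m. 0 < m \<and> (0, m) \<in> A}" "infinite {m. 0 < m \<and> (m, 0) \<in> A}"
    using A.infinite_column_if_row B.infinite_column_if_row unfolding mem by blast+
  then obtain m1 m2 where "\<forall>m\<ge>m1. (0, m) \<in> A" "\<forall>m\<ge>m2. (m, 0) \<in> A"
    using A.row_cofinite B.row_cofinite unfolding mem by blast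
  then show ?thesis
    by (intro exI[of _ "max m1 m2"]) auto
qed

text \<open>The witnesses are \<open>(0, m)\<close> and \<open>(m, 0)\<close> with \<open>m\<close>
  large. \<open>F\<close> will be the part of \<open>A\<close> outside a given neighbourhood of
  zero.\<close>

lemma translation_stable_product_hits_unit:
  assumes "translation_stable A" "infinite A" "finite F"
  shows "\<exists>x\<in>A - F. \<exists>y\<in>A - F. ext_bicyclic_mult x y = (0, 0)"
proof -
  obtain m0 where m0: "\<forall>m\<ge>m0. (0, m) \<in> A \<and> (m, 0) \<in> A"
    using translation_stable_row_and_column assms(1,2) by blast
  have "finite (fst ` F \<union> snd ` F)"
    using assms(3) by simp
  then obtain N where N: "\<And>n. n \<in> fst ` F \<union> snd ` F \<Longrightarrow> n \<le> N"
    using bdd_above_finite unfolding bdd_above_def by meson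
  define m where "m = max m0 (N + 1)"
  have "(0, m) \<notin> F" "(m, 0) \<notin> F"
    using N[of m] by (force simp: m_def)+
  then show ?thesis
    using m0 by (intro bexI[of _ "(0, m)"] bexI[of _ "(m, 0)"]) (auto simp: m_def)
qed

text \<open>If the first coordinate of \<open>z\<close> exceeds \<open>c\<close>, the product has
  first coordinate above \<open>a\<close>. Otherwise the left product is
  \<open>(a, v + c - u)\<close> for \<open>z = (u, v)\<close>, and equality forces
  \<open>v + c - u = d\<close>.\<close>

lemma ext_bicyclic_sandwich_eq_iff:
  "ext_bicyclic_mult (ext_bicyclic_mult (a, c) z) (d, b) = (a, b) \<longleftrightarrow> (\<exists>k\<ge>0. z = (c - k, d - k))"
proof (cases z)
  case (Pair u v)
  have "ext_bicyclic_mult (ext_bicyclic_mult (a, c) z) (d, b) = (a, b) \<longleftrightarrow> u \<le> c \<and> d - v = c - u"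
    by (auto simp: Pair)
  also have "\<dots> \<longleftrightarrow> (\<exists>k\<ge>0. z = (c - k, d - k))"
    by (auto simp: Pair intro: exI[of _ "c - u"])
  finally show ?thesis .
qed

section \<open>Baire's theorem and isolation of the nonzero points\<close>

locale locally_compact_ext_bicyclic0 =
  fixes T :: "(int \<times> int) option topology"
  assumes top: "semigroup_topology ext_bicyclic0_mult T"
    and Hausdorff: "Hausdorff_space T"
    and locally_compact: "locally_compact_space T"
begin

lemma topspace_UNIV [simp]: "topspace T = UNIV"
  using top by (simp add: semigroup_topology_def)

lemma mult_Some [simp]: "ext_bicyclic0_mult (Some x) (Some y) = Some (ext_bicyclic_mult x y)"
  and mult_None_left [simp]: "ext_bicyclic0_mult None p = None"
  and mult_None_right [simp]: "ext_bicyclic0_mult p None = None"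
  by (cases p; simp add: ext_bicyclic0_mult_def)+

lemma continuous_mult: "continuous_map (prod_topology T T) T (\<lambda>(x, y). ext_bicyclic0_mult x y)"
  using top by (simp add: semigroup_topology_def)

lemma continuous_left: "continuous_map T T (ext_bicyclic0_mult s)"
  using continuous_map_compose[OF continuous_map_pairedI continuous_mult, of T "\<lambda>_. s" "\<lambda>x. x"]
  by (simp add: o_def)

lemma continuous_right: "continuous_map T T (\<lambda>x. ext_bicyclic0_mult x s)"
  using continuous_map_compose[OF continuous_map_pairedI continuous_mult, of T "\<lambda>x. x" "\<lambda>_. s"]
  by (simp add: o_def)

lemma closedin_singleton: "closedin T {x}"
  using Hausdorff by (simp add: closedin_Hausdorff_sing_eq)

lemma openin_cofinite: "finite F \<Longrightarrow> openin T (- F)"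
  using closedin_Hausdorff_finite[OF Hausdorff, of F] by (simp add: closedin_def Compl_eq_Diff_UNIV)

lemma exists_isolated_nonzero: "\<exists>x. openin T {Some x}"
proof (rule ccontr)
  assume none: "\<nexists>x. openin T {Some x}"
  have "T interior_of \<Union> (range (\<lambda>x. {Some x})) = {}"
  proof (rule Baire_category_alt)
    show "completely_metrizable_space T \<or> locally_compact_space T \<and> regular_space T"
      using locally_compact Hausdorff locally_compact_Hausdorff_imp_regular_space by blast
    fix G :: "(int \<times> int) option set"
    assume "G \<in> range (\<lambda>x. {Some x})"
    then obtain x where G: "G = {Some x}" by blast
    have "T interior_of G = {}"
      using none interior_of_subset[of T G] openin_interior_of[of T G] unfolding G
      by (metis subset_singletonD)
    then show "closedin T G \<and> T interior_of G = {}"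
      using G closedin_singleton by simp
  qed simp
  \<comment> \<open>The nonzero points form a nonempty open set, so it cannot have empty
    interior.\<close>
  moreover have "openin T (\<Union> (range (\<lambda>x. {Some x})))"
  proof -
    have "\<Union> (range (\<lambda>x. {Some x})) = - {None :: (int \<times> int) option}"
      by (auto simp flip: not_None_eq simp del: split_paired_Ex)
    then show ?thesis
      using openin_cofinite[of "{None}"] by simp
  qed
  ultimately show False
    by (simp add: interior_of_openin)
qed

text \<open>The set of elements above \<open>(c, d)\<close> in the natural order is clopen, being the preimage of an
  isolated point under a two-sided translation; removing from it the set above
  \<open>(c - 1, d - 1)\<close> leaves only \<open>(c, d)\<close>.\<close>

lemma isolated_nonzero: "openin T {Some x}"
proof -
  obtain a b where ab: "openin T {Some (a, b)}"
    using exists_isolated_nonzero by auto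
  define up where "up c d = {p. ext_bicyclic0_mult (ext_bicyclic0_mult (Some (a, c)) p) (Some (d, b)) = Some (a, b)}" for c d
  have up: "up c d = {Some (c - k, d - k) | k. 0 \<le> k}" for c d
  proof -
    have "p \<in> up c d \<longleftrightarrow> (\<exists>k\<ge>0. p = Some (c - k, d - k))" for p
      by (cases p) (simp_all add: up_def ext_bicyclic_sandwich_eq_iff del: ext_bicyclic_mult.simps)
    then show ?thesis by blast
  qed
  have cont: "continuous_map T T (\<lambda>p. ext_bicyclic0_mult (ext_bicyclic0_mult (Some (a, c)) p) (Some (d, b)))" for c d
    using continuous_map_compose[OF continuous_left continuous_right] by (simp add: o_def)
  have opn: "openin T (up c d)" for c d
    using openin_continuous_map_preimage[OF cont ab] by (simp add: up_def)
  have cls: "closedin T (up c d)" for c d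
    using closedin_continuous_map_preimage[OF cont closedin_singleton] by (simp add: up_def)
  obtain c d where x: "x = (c, d)" by (cases x)
  have "up c d - up (c - 1) (d - 1) = {Some x}"
  proof -
    have "p \<in> up c d - up (c - 1) (d - 1) \<longleftrightarrow> p = Some x" for p
    proof
      assume p: "p \<in> up c d - up (c - 1) (d - 1)"
      then obtain k where k: "p = Some (c - k, d - k)" "0 \<le> k"
        unfolding up by blast
      \<comment> \<open>Otherwise \<open>k - 1\<close> would witness membership in the removed
        set.\<close>
      have "\<not> 0 \<le> k - 1"
        using p k unfolding up by (auto dest: spec[of _ "k - 1"])
      then show "p = Some x"
        using k x by simp
    next
      assume "p = Some x"
      then show "p \<in> up c d - up (c - 1) (d - 1)"
        unfolding up x by (auto intro: exI[of _ 0])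
    qed
    then show ?thesis by blast
  qed
  then show ?thesis
    using openin_diff[OF opn cls] by metis
qed

lemma openin_if_nonzero: "None \<notin> U \<Longrightarrow> openin T U"
proof (subst openin_subopen, intro ballI)
  fix p assume "p \<in> U" "None \<notin> U"
  then obtain x where "p = Some x"
    by (cases p) auto
  then show "\<exists>V. openin T V \<and> p \<in> V \<and> V \<subseteq> U"
    using isolated_nonzero \<open>p \<in> U\<close> by blast
qed

lemma openin_superset:
  assumes "openin T U" "None \<in> U" "U \<subseteq> V"
  shows "openin T V"
proof -
  have "V = U \<union> (V - {None})"
    using assms by blast
  then show ?thesis
    using assms(1) openin_if_nonzero by (metis Diff_iff openin_Un singletonI)
qed

text \<open>\<open>K - V\<close> is compact and omits zero, so its points are isolated and none is a
  limit point; Bolzano-Weierstrass makes it finite.\<close>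

lemma finite_compact_diff:
  assumes "compactin T K" "openin T V" "None \<in> V"
  shows "finite (K - V)"
proof -
  have "compactin T (K - V)"
    using compact_Int_closedin[OF assms(1) closedin_diff[OF closedin_topspace assms(2)]]
    by (simp add: Diff_eq)
  moreover have "(K - V) \<inter> T derived_set_of (K - V) = {}"
  proof -
    have "p \<notin> T derived_set_of (K - V)" if "p \<in> K - V" for p
      using that assms(3) isolated_nonzero
      by (cases p) (auto simp: in_derived_set_of)
    then show ?thesis by blast
  qed
  ultimately show ?thesis
    using compactin_imp_Bolzano_Weierstrass by blast
qed

section \<open>Isolation of zero\<close>

lemma isolated_zero: "openin T {None}"
proof (rule ccontr)
  assume not_isolated: "\<not> openin T {None}"
  obtain U K where UK: "openin T U" "None \<in> U" "compactin T K" "U \<subseteq> K"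
    using locally_compact unfolding locally_compact_space_def topspace_UNIV by blast
  have K: "openin T K" "None \<in> K"
    using openin_superset UK by auto
  define A where "A = {z. Some z \<in> K}"
  have almost_all: "finite {z \<in> A. Some z \<notin> V}" if "openin T V" "None \<in> V" for V
  proof -
    have "Some ` {z \<in> A. Some z \<notin> V} \<subseteq> K - V"
      by (auto simp: A_def)
    then show ?thesis
      using finite_compact_diff[OF UK(3) that] by (meson finite_subset finite_imageD inj_Some inj_on_subset subset_UNIV)
  qed
  have infinite_A: "infinite A"
  proof
    assume "finite A"
    then have "openin T (K \<inter> - (Some ` A))"
      using K openin_cofinite by blast
    moreover have "K \<inter> - (Some ` A) = {None}"
    proof -
      have "p \<in> K \<inter> - (Some ` A) \<longleftrightarrow> p = None" for p
        using K(2) by (cases p) (auto simp: A_def)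
      then show ?thesis by blast
    qed
    ultimately show False
      using not_isolated by simp
  qed
  have stable: "finite {z \<in> A. f (Some z) \<notin> V}"
    if "continuous_map T T f" "f None = None" "openin T V" "None \<in> V" for f V
    using almost_all[OF openin_continuous_map_preimage[OF that(1,3)]] that(2,4) by simp
  have "translation_stable A"
  proof
    fix s w
    show "finite {z \<in> A. ext_bicyclic_mult s z \<notin> A}"
      using stable[OF continuous_left _ K, of "Some s"] by (simp add: A_def)
    show "finite {z \<in> A. ext_bicyclic_mult z s \<notin> A}"
      using stable[OF continuous_right _ K, of "Some s"] by (simp add: A_def)
    \<comment> \<open>The complement of \<open>{Some w}\<close> is an open neighbourhood of zero, so
      a fibre is a set of exceptions for it.\<close>
    show "finite {z \<in> A. ext_bicyclic_mult s z = w}"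
      using stable[OF continuous_left _ openin_cofinite, of "Some s" "{Some w}"] by simp
    show "finite {z \<in> A. ext_bicyclic_mult z s = w}"
      using stable[OF continuous_right _ openin_cofinite, of "Some s" "{Some w}"] by simp
  qed
  moreover obtain V W where VW: "openin T V" "openin T W" "None \<in> V" "None \<in> W"
      "\<And>x y. x \<in> V \<Longrightarrow> y \<in> W \<Longrightarrow> ext_bicyclic0_mult x y \<noteq> Some (0, 0)"
  proof -
    \<comment> \<open>This open set contains \<open>(None, None)\<close>, hence an open rectangle
      \<open>V \<times> W\<close> around it.\<close>
    have "openin (prod_topology T T) {p. (case p of (x, y) \<Rightarrow> ext_bicyclic0_mult x y) \<in> - {Some (0, 0)}}"
      using openin_continuous_map_preimage[OF continuous_mult openin_cofinite, of "{Some (0, 0)}"] by simp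
    then show ?thesis
      unfolding openin_prod_topology_alt using that by (fastforce dest!: spec[of _ None])
  qed
  moreover define F where "F = {z \<in> A. Some z \<notin> V \<inter> W}"
  moreover have "finite F"
    unfolding F_def using VW by (intro almost_all) auto
  ultimately obtain x y where "x \<in> A - F" "y \<in> A - F" "ext_bicyclic_mult x y = (0, 0)"
    using translation_stable_product_hits_unit infinite_A by metis
  then show False
    using VW(5)[of "Some x" "Some y"] by (auto simp: F_def)
qed

end

theorem corollary3:
  fixes T :: "(int \<times> int) option topology"
  assumes "semigroup_topology ext_bicyclic0_mult T"
    and "Hausdorff_space T"
    and "locally_compact_space T"
  shows "T = discrete_topology UNIV"
proof -
  interpret locally_compact_ext_bicyclic0 T
    using assms by unfold_locales
  have "openin T {p}" for p
    using isolated_nonzero isolated_zero by (cases p) auto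
  then show ?thesis
    by (metis discrete_topology_unique topspace_UNIV)
qed

end
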